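(* Let $M\subseteq F$ be an $A$-submodule generated by $f_1,\dots,f_r$. Let $A^{s}\xrightarrow{\ \Phi\ }A^{r}\to F$ be a presentation of $\langle \operatorname{in}_{(\omega,\epsilon)}(f_1),\dots,\operatorname{in}_{(\omega,\epsilon)}(f_r)\rangle$, i.e. an exact sequence in which the second map sends the $i$-th basis element of $A^r$ to $\operatorname{in}_{(\omega,\epsilon)}(f_i)$ and $\Phi$ is a matrix with entries in $A$. Regard $\Phi$ also as a map $\tilde A^{s}\to\tilde A^{r}$, and let $(\tilde f_1,\dots,\tilde f_r):\tilde A^r\to\tilde F$ be the map sending the $i$-th basis element to $\tilde f_i$; the image of $(\tilde f_1,\dots,\tilde f_r)\circ\Phi$ is contained in $t\tilde F$. If $$\tfrac{1}{t}\,\bigl((\tilde f_1,\dots,\tilde f_r)\circ\Phi\bigr)(\tilde A^{s})\subseteq\langle\tilde f_1,\dots,\tilde f_r\rangle,$$ then $\operatorname{in}_{(\omega,\epsilon)}(M)=\langle \operatorname{in}_{(\omega,\epsilon)}(f_1),\dots,\operatorname{in}_{(\omega,\epsilon)}(f_r)\rangle$.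
   Context: $K$ is a field, $A=K[X_1,\dots,X_n]$ is a polynomial ring, $\omega=(w_1,\dots,w_n)\in\mathbb Z_{\ge 0}^n$ is a weight, $F=\bigoplus_{j=1}^m A(-d_j)=\bigoplus_{j=1}^m Ae_j$ is a free graded $A$-module with basis $e_1,\dots,e_m$ of degrees $d_1,\dots,d_m$, and $\epsilon=(\epsilon_1,\dots,\epsilon_m)$ is a vector of non-negative integers. The weight of the monomial $\mathbf X^{\mathbf u}e_j\in F$ is $\omega\cdot\mathbf u+\epsilon_j$. For $0\ne f\in F$, $\operatorname{in}_{(\omega,\epsilon)}(f)$ is the sum of all terms (monomials with their coefficients) of $f$ of largest weight. For a submodule $M\subseteq F$, $\operatorname{in}_{(\omega,\epsilon)}(M)$ is the submodule of $F$ generated by all $\operatorname{in}_{(\omega,\epsilon)}(f)$, $f\in M$. Set $\tilde A=A[t]$ and $\tilde F=\bigoplus_{j=1}^m\tilde Ae_j$. For $f=\sum c_{\mathbf u,j}\mathbf X^{\mathbf u}e_j\in F$ nonzero, its homogenization is $\tilde f=t^{d}\sum c_{\mathbf u,j}(t^{-\omega\cdot\mathbf u}\mathbf X^{\mathbf u})(t^{-\epsilon_j}e_j)\in\tilde F$, where $d$ is the largest weight of a monomial in the support of $f$. Evaluating $t$ at $0$ sends $\tilde f$ to $\operatorname{in}_{(\omega,\epsilon)}(f)$. The symbol $\langle\cdots\rangle$ denotes the generated submodule. *)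

theory Defs
  imports
    "HOL-Analysis.Analysis"
    "HOL-Computational_Algebra.Polynomial"
    "HOL-Library.Poly_Mapping"
begin

text \<open>
  The variables $X_1, \dots, X_n$ are indexed by a finite type \<open>'n\<close>, the basis
  $e_1, \dots, e_m$ of $F$ by a finite type \<open>'m\<close>. The degrees $d_j$ of the basis elements do
  not enter initial forms, homogenizations or generated submodules, so $F$ is used with its module
  structure only.
\<close>

type_synonym 'n mono = "'n \<Rightarrow>\<^sub>0 nat"
type_synonym ('n, 'k) mpol = "('n \<Rightarrow>\<^sub>0 nat) \<Rightarrow>\<^sub>0 'k"
type_synonym ('n, 'k, 'm) free_mod = "(('n, 'k) mpol) ^ 'm"

text \<open>$\tilde A = A[t]$ and $\tilde F$\<close>

type_synonym ('n, 'k) mpol_t = "('n, 'k) mpol poly"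
type_synonym ('n, 'k, 'm) free_mod_t = "(('n, 'k) mpol poly) ^ 'm"

lemma module_vec: "module ((*s) :: 'a::comm_ring_1 \<Rightarrow> 'a ^ 'm \<Rightarrow> 'a ^ 'm)"
  by unfold_locales (simp_all add: vec_eq_iff algebra_simps)

abbreviation submod_gen :: "('a::comm_ring_1 ^ 'm) set \<Rightarrow> ('a ^ 'm) set" where
  "submod_gen \<equiv> module.span (*s)"

definition mon_weight :: "('n::finite \<Rightarrow> nat) \<Rightarrow> ('m \<Rightarrow> nat) \<Rightarrow> 'n mono \<Rightarrow> 'm \<Rightarrow> nat" where
  "mon_weight \<omega> \<epsilon> u j = (\<Sum>x\<in>UNIV. \<omega> x * Poly_Mapping.lookup u x) + \<epsilon> j"

text \<open>Only meaningful for \<open>f \<noteq> 0\<close>; the support of \<open>0\<close> is empty.\<close>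

definition max_weight ::
  "('n::finite \<Rightarrow> nat) \<Rightarrow> ('m::finite \<Rightarrow> nat) \<Rightarrow> ('n, 'k::zero, 'm) free_mod \<Rightarrow> nat" where
  "max_weight \<omega> \<epsilon> f = Max {mon_weight \<omega> \<epsilon> u j | u j. u \<in> Poly_Mapping.keys (f $ j)}"

text \<open>For \<open>f = 0\<close> the sums below are empty, so \<open>initial_form\<close> and \<open>homog\<close> send \<open>0\<close> to \<open>0\<close>.\<close>

definition initial_form ::
  "('n::finite \<Rightarrow> nat) \<Rightarrow> ('m::finite \<Rightarrow> nat) \<Rightarrow> ('n, 'k::comm_ring_1, 'm) free_mod
    \<Rightarrow> ('n, 'k, 'm) free_mod" where
  "initial_form \<omega> \<epsilon> f =
     (\<chi> j. \<Sum>u\<in>{u \<in> Poly_Mapping.keys (f $ j). mon_weight \<omega> \<epsilon> u j = max_weight \<omega> \<epsilon> f}.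
        Poly_Mapping.single u (Poly_Mapping.lookup (f $ j) u))"

definition initial_module ::
  "('n::finite \<Rightarrow> nat) \<Rightarrow> ('m::finite \<Rightarrow> nat) \<Rightarrow> ('n, 'k::comm_ring_1, 'm) free_mod set
    \<Rightarrow> ('n, 'k, 'm) free_mod set" where
  "initial_module \<omega> \<epsilon> M = submod_gen {initial_form \<omega> \<epsilon> f | f. f \<in> M \<and> f \<noteq> 0}"

text \<open>
  The factors $t^d t^{-\omega\cdot u} t^{-\epsilon_j}$ of each term are combined into the single power
  of $t$ below; its exponent is a genuine (non-truncated) difference, as $d$ is the largest weight.
\<close>

definition homog ::
  "('n::finite \<Rightarrow> nat) \<Rightarrow> ('m::finite \<Rightarrow> nat) \<Rightarrow> ('n, 'k::comm_ring_1, 'm) free_mod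
    \<Rightarrow> ('n, 'k, 'm) free_mod_t" where
  "homog \<omega> \<epsilon> f =
     (\<chi> j. \<Sum>u\<in>Poly_Mapping.keys (f $ j).
        monom (Poly_Mapping.single u (Poly_Mapping.lookup (f $ j) u))
              (max_weight \<omega> \<epsilon> f - mon_weight \<omega> \<epsilon> u j))"

text \<open>
  Elements of $R^r$ are functions on \<open>nat\<close> of which only the values at \<open>i < r\<close> matter;
  this covers $r = 0$ and $s = 0$. Likewise \<open>\<Phi> i k\<close> is the entry of an $r \times s$ matrix
  in row \<open>i < r\<close> and column \<open>k < s\<close>.
\<close>

definition gens_map ::
  "nat \<Rightarrow> (nat \<Rightarrow> 'a::comm_ring_1 ^ 'm) \<Rightarrow> (nat \<Rightarrow> 'a) \<Rightarrow> 'a ^ 'm" where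
  "gens_map r g a = (\<Sum>i<r. a i *s g i)"

definition mat_map ::
  "nat \<Rightarrow> (nat \<Rightarrow> nat \<Rightarrow> 'a::comm_ring_1) \<Rightarrow> (nat \<Rightarrow> 'a) \<Rightarrow> (nat \<Rightarrow> 'a)" where
  "mat_map s \<Phi> b = (\<lambda>i. \<Sum>k<s. \<Phi> i k * b k)"

text \<open>
  Exactness of $R^s \to R^r \to R^m$ in the middle. The image of the second map is the submodule
  generated by the \<open>g i\<close>, so this says that it is a presentation of that submodule.
\<close>

definition is_presentation ::
  "nat \<Rightarrow> nat \<Rightarrow> (nat \<Rightarrow> nat \<Rightarrow> 'a::comm_ring_1) \<Rightarrow> (nat \<Rightarrow> 'a ^ 'm) \<Rightarrow> bool" where
  "is_presentation s r \<Phi> g \<longleftrightarrow>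
     (\<forall>a. gens_map r g a = 0 \<longleftrightarrow> (\<exists>b. \<forall>i<r. a i = mat_map s \<Phi> b i))"

text \<open>The image of $(\tilde f_1, \dots, \tilde f_r) \circ \Phi$ on $\tilde A^s$.\<close>

definition homog_syz_image ::
  "('n::finite \<Rightarrow> nat) \<Rightarrow> ('m::finite \<Rightarrow> nat) \<Rightarrow> nat \<Rightarrow> nat
    \<Rightarrow> (nat \<Rightarrow> nat \<Rightarrow> ('n, 'k::comm_ring_1) mpol) \<Rightarrow> (nat \<Rightarrow> ('n, 'k, 'm) free_mod)
    \<Rightarrow> ('n, 'k, 'm) free_mod_t set" where
  "homog_syz_image \<omega> \<epsilon> s r \<Phi> f =
     {gens_map r (\<lambda>i. homog \<omega> \<epsilon> (f i)) (mat_map s (\<lambda>i k. [:\<Phi> i k:]) b) | b. True}"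

definition tvar :: "'a::comm_ring_1 poly" where
  "tvar = [:0, 1:]"

text \<open>
  $\frac1t N$ for $N \subseteq t\tilde F$: as $t$ is a nonzerodivisor on $\tilde F$, each element of
  such an $N$ has exactly one quotient by $t$.
\<close>

definition div_t :: "('a::comm_ring_1 poly ^ 'm) set \<Rightarrow> ('a poly ^ 'm) set" where
  "div_t N = {g. tvar *s g \<in> N}"

lemma tvar_smult_inj: "inj ((*s) tvar :: 'a::comm_ring_1 poly ^ 'm \<Rightarrow> _)"
  by (rule injI) (simp add: vec_eq_iff tvar_def)

lemma max_weight_ge:
  assumes "u \<in> Poly_Mapping.keys (f $ j)"
  shows "mon_weight \<omega> \<epsilon> u j \<le> max_weight \<omega> \<epsilon> f"
proof -
  have eq: "{mon_weight \<omega> \<epsilon> u j | u j. u \<in> Poly_Mapping.keys (f $ j)} =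
      (\<Union>j. (\<lambda>u. mon_weight \<omega> \<epsilon> u j) ` Poly_Mapping.keys (f $ j))"
    by auto
  have "finite {mon_weight \<omega> \<epsilon> u j | u j. u \<in> Poly_Mapping.keys (f $ j)}"
    unfolding eq by simp
  then show ?thesis
    unfolding max_weight_def using assms by (intro Max_ge) auto
qed

text \<open>Setting $t = 0$ in the homogenization gives the initial form.\<close>

lemma homog_at_0:
  fixes f :: "('n::finite, 'k::comm_ring_1, 'm::finite) free_mod"
  shows "(\<chi> j. poly (homog \<omega> \<epsilon> f $ j) 0) = initial_form \<omega> \<epsilon> f"
proof -
  have "(if max_weight \<omega> \<epsilon> f - mon_weight \<omega> \<epsilon> u j = 0 then c else 0) =
        (if mon_weight \<omega> \<epsilon> u j = max_weight \<omega> \<epsilon> f then c else 0)"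
    if "u \<in> Poly_Mapping.keys (f $ j)" for u j and c :: "('n, 'k) mpol"
    using max_weight_ge[OF that, of \<omega> \<epsilon>] by auto
  then show ?thesis
    by (simp add: vec_eq_iff homog_def initial_form_def poly_0_coeff_0 coeff_sum coeff_monom
        sum.inter_filter del: diff_is_0_eq cong: sum.cong)
qed

end

theory Submission
  imports Defs
begin

text \<open>
  Let \<open>N\<close> be the submodule of the free \<open>A[t]\<close>-module generated by the homogenizations of the
  \<open>f i\<close>. Setting \<open>t = 0\<close> sends a homogenization to the initial form, so it maps \<open>N\<close> into the
  submodule generated by the initial forms of the \<open>f i\<close>. It therefore suffices that the
  homogenization of every \<open>g \<in> M\<close> lies in \<open>N\<close>. This follows from two facts.

  Some power of \<open>t\<close> times the homogenization of \<open>g\<close> always lies in \<open>N\<close>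
  (\<open>eventually_homog_to_mem\<close>, \<open>homog_to_eq_tvar_power\<close>). Indeed, homogenizing a relation
  \<open>g = \<Sum>i. a i *s f i\<close> requires multiplying all terms up to one common weight, which costs powers of
  \<open>t\<close> as soon as leading terms cancel on the right.

  Under the hypothesis on the columns of \<open>\<Phi>\<close>, \<open>t\<close> can be cancelled: \<open>t *s g \<in> N\<close> implies
  \<open>g \<in> N\<close> (\<open>tvar_saturated\<close>). If \<open>t *s g\<close> is a combination of the homogenizations with
  coefficients \<open>a i\<close>, then at \<open>t = 0\<close> the \<open>a i\<close> become a syzygy of the initial forms, that is, an
  element of the image of \<open>\<Phi>\<close>. Up to multiples of \<open>t\<close> in the coefficients, which can be cancelled
  at once, \<open>t *s g\<close> thus lies in the image that the hypothesis allows to divide by \<open>t\<close>.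
\<close>

section \<open>Submodules of a free module\<close>

interpretation free_module: module "(*s) :: 'a::comm_ring_1 \<Rightarrow> 'a ^ 'm \<Rightarrow> 'a ^ 'm"
  by (rule module_vec)

lemma gens_map_add: "gens_map r g (\<lambda>i. a i + b i) = gens_map r g a + gens_map r g b"
  by (simp add: gens_map_def free_module.scale_left_distrib sum.distrib)

lemma gens_map_scale: "gens_map r g (\<lambda>i. c * a i) = c *s gens_map r g a"
  by (simp add: gens_map_def free_module.scale_sum_right)

lemma submod_gen_eq_range_gens_map: "submod_gen (g ` {..<r}) = range (gens_map r g)"
proof
  have "free_module.subspace (range (gens_map r g))"
  proof (rule free_module.subspaceI)
    have "gens_map r g (\<lambda>_. 0) = 0"
      by (simp add: gens_map_def)
    then show "0 \<in> range (gens_map r g)"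
      by (metis rangeI)
  qed (auto simp flip: gens_map_add gens_map_scale)
  moreover have "g i = gens_map r g (\<lambda>k. if k = i then 1 else 0)" if "i < r" for i
    using that by (simp add: gens_map_def if_distrib[of "\<lambda>c. c *s _"] sum.delta cong: if_cong)
  then have "g ` {..<r} \<subseteq> range (gens_map r g)"
    by auto
  ultimately show "submod_gen (g ` {..<r}) \<subseteq> range (gens_map r g)"
    by (simp add: free_module.span_minimal)
next
  show "range (gens_map r g) \<subseteq> submod_gen (g ` {..<r})"
    by (auto simp: gens_map_def
        intro!: free_module.span_sum intro: free_module.span_scale free_module.span_base)
qed

section \<open>Evaluation at zero and divisibility by the parameter\<close>

definition eval_0 :: "'a::comm_ring_1 poly ^ 'm \<Rightarrow> 'a ^ 'm" where
  "eval_0 g = (\<chi> j. poly (g $ j) 0)"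

lemma eval_0_gens_map: "eval_0 (gens_map r g a) = gens_map r (\<lambda>i. eval_0 (g i)) (\<lambda>i. poly (a i) 0)"
  by (simp add: eval_0_def gens_map_def vec_eq_iff poly_sum)

lemma eval_0_homog: "eval_0 (homog \<omega> \<epsilon> f) = initial_form \<omega> \<epsilon> f"
  by (simp add: eval_0_def homog_at_0)

lemma poly_split_at_0: "\<exists>q. p = [:poly p 0:] + tvar * q"
  by (cases p) (auto simp: tvar_def)

text \<open>
  The kernel of evaluation at \<open>0\<close> is \<open>t\<close> times the module, because each component splits into its
  constant coefficient and a multiple of \<open>t\<close>.
\<close>

lemma eval_0_eq_0_imp_dvd_tvar:
  assumes "eval_0 g = 0"
  shows "g \<in> range ((*s) tvar)"
proof -
  have "\<exists>q. g $ j = tvar * q" for j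
    using assms poly_split_at_0[of "g $ j"] by (simp add: eval_0_def vec_eq_iff)
  then obtain q where "\<And>j. g $ j = tvar * q j"
    by metis
  then have "g = tvar *s (\<chi> j. q j)"
    by (simp add: vec_eq_iff)
  then show ?thesis
    by blast
qed

text \<open>
  At \<open>t = 0\<close> the homogenizations become the initial forms while the entries of \<open>\<Phi>\<close> stay the same, so
  the composite specializes to the zero map of the presentation.
\<close>

lemma syzygy_image_subset_tvar:
  assumes "is_presentation s r \<Phi> (\<lambda>i. initial_form \<omega> \<epsilon> (f i))"
  shows "homog_syz_image \<omega> \<epsilon> s r \<Phi> f \<subseteq> range ((*s) tvar)"
proof
  fix g assume "g \<in> homog_syz_image \<omega> \<epsilon> s r \<Phi> f"
  then obtain b where "g = gens_map r (\<lambda>i. homog \<omega> \<epsilon> (f i)) (mat_map s (\<lambda>i k. [:\<Phi> i k:]) b)"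
    unfolding homog_syz_image_def by blast
  then have "eval_0 g = gens_map r (\<lambda>i. initial_form \<omega> \<epsilon> (f i)) (mat_map s \<Phi> (\<lambda>k. poly (b k) 0))"
    by (simp add: eval_0_gens_map eval_0_homog mat_map_def poly_sum)
  also have "\<dots> = 0"
    using assms unfolding is_presentation_def by blast
  finally show "g \<in> range ((*s) tvar)"
    by (rule eval_0_eq_0_imp_dvd_tvar)
qed

text \<open>
  A local flatness criterion: \<open>t\<close> is a nonzerodivisor on the quotient by the homogenizations as
  soon as the syzygies of the special fibre \<open>t = 0\<close> lift. The coefficients of \<open>t *s g\<close> are split as \<open>a i = a i(0) + t * q i\<close>. The
  constant parts form a syzygy of the initial forms, hence come from \<open>\<Phi>\<close>, and what remains of \<open>g\<close>
  after subtracting the combination with coefficients \<open>q i\<close> is covered by the lifting hypothesis.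
\<close>

lemma tvar_saturated:
  fixes f :: "nat \<Rightarrow> ('n::finite, 'k::comm_ring_1, 'm::finite) free_mod"
  assumes pres: "is_presentation s r \<Phi> (\<lambda>i. initial_form \<omega> \<epsilon> (f i))"
    and lift: "div_t (homog_syz_image \<omega> \<epsilon> s r \<Phi> f) \<subseteq> submod_gen ((\<lambda>i. homog \<omega> \<epsilon> (f i)) ` {..<r})"
    and mem: "tvar *s g \<in> submod_gen ((\<lambda>i. homog \<omega> \<epsilon> (f i)) ` {..<r})"
  shows "g \<in> submod_gen ((\<lambda>i. homog \<omega> \<epsilon> (f i)) ` {..<r})"
proof -
  let ?N = "submod_gen ((\<lambda>i. homog \<omega> \<epsilon> (f i)) ` {..<r})"
  let ?h = "\<lambda>i. homog \<omega> \<epsilon> (f i)"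
  obtain a where a: "tvar *s g = gens_map r ?h a"
    using mem unfolding submod_gen_eq_range_gens_map by blast
  obtain q where q: "\<And>i. a i = [:poly (a i) 0:] + tvar * q i"
    using choice[of "\<lambda>i q. a i = [:poly (a i) 0:] + tvar * q"] poly_split_at_0 by blast
  have "gens_map r (\<lambda>i. initial_form \<omega> \<epsilon> (f i)) (\<lambda>i. poly (a i) 0) = eval_0 (tvar *s g)"
    by (simp add: a eval_0_gens_map eval_0_homog)
  also have "\<dots> = 0"
    by (simp add: eval_0_def vec_eq_iff tvar_def)
  finally have "\<exists>b. \<forall>i<r. poly (a i) 0 = mat_map s \<Phi> b i"
    by (rule pres[unfolded is_presentation_def, rule_format, THEN iffD1])
  then obtain b where b: "\<And>i. i < r \<Longrightarrow> poly (a i) 0 = mat_map s \<Phi> b i"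
    by blast
  let ?\<Phi>b = "mat_map s (\<lambda>i k. [:\<Phi> i k:]) (\<lambda>k. [:b k:])"
  \<comment> \<open>The syzygy over \<open>A\<close>, viewed over \<open>A[t]\<close>, is the image of constant coefficients under the same matrix.\<close>
  have const: "[:mat_map s \<Phi> b i:] = ?\<Phi>b i" for i
    by (intro poly_eqI) (simp add: mat_map_def coeff_sum coeff_pCons mult.commute split: nat.split)
  have "a i = ?\<Phi>b i + tvar * q i" if "i < r" for i
    using q[of i] unfolding b[OF that] const .
  then have "gens_map r ?h a = gens_map r ?h (\<lambda>i. ?\<Phi>b i + tvar * q i)"
    by (simp add: gens_map_def)
  then have "tvar *s (g - gens_map r ?h q) = gens_map r ?h ?\<Phi>b"
    by (simp add: a gens_map_add gens_map_scale free_module.scale_right_diff_distrib)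
  then have "g - gens_map r ?h q \<in> div_t (homog_syz_image \<omega> \<epsilon> s r \<Phi> f)"
    unfolding div_t_def homog_syz_image_def by auto
  then have "g - gens_map r ?h q \<in> ?N"
    using lift by blast
  moreover have "gens_map r ?h q \<in> ?N"
    unfolding submod_gen_eq_range_gens_map by blast
  ultimately show ?thesis
    using free_module.span_add by fastforce
qed

section \<open>Homogenization with respect to a prescribed weight\<close>

text \<open>
  If \<open>v u\<close> could be minus the weight of \<open>u\<close>, this would be the ring homomorphism that multiplies
  each variable by the corresponding negative power of \<open>t\<close>. Exponents of \<open>t\<close> are natural numbers here, so \<open>v\<close> is left
  arbitrary; the map is then additive but not multiplicative, and a monomial factor acts by a shift
  of \<open>v\<close>.
\<close>

definition regrade :: "('n mono \<Rightarrow> nat) \<Rightarrow> ('n, 'k::comm_ring_1) mpol \<Rightarrow> ('n, 'k) mpol_t" where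
  "regrade v p = (\<Sum>u\<in>Poly_Mapping.keys p. monom (Poly_Mapping.single u (Poly_Mapping.lookup p u)) (v u))"

lemma regrade_superset:
  assumes "finite U" "Poly_Mapping.keys p \<subseteq> U"
  shows "regrade v p = (\<Sum>u\<in>U. monom (Poly_Mapping.single u (Poly_Mapping.lookup p u)) (v u))"
  unfolding regrade_def by (rule sum.mono_neutral_left) (use assms in \<open>auto simp: in_keys_iff\<close>)

lemma regrade_0: "regrade v 0 = 0"
  by (simp add: regrade_def)

lemma regrade_add: "regrade v (p + q) = regrade v p + regrade v q"
proof -
  let ?U = "Poly_Mapping.keys p \<union> Poly_Mapping.keys q"
  show ?thesis
    using keys_add[of p q]
    by (simp add: regrade_superset[of ?U] lookup_add single_add add_monom flip: sum.distrib)
qed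

lemma regrade_single: "regrade v (Poly_Mapping.single u c) = monom (Poly_Mapping.single u c) (v u)"
  by (simp add: regrade_def)

lemma mpol_induct [case_names zero single add]:
  fixes p :: "('n, 'k::comm_ring_1) mpol"
  assumes "P 0" and "\<And>u c. P (Poly_Mapping.single u c)" and "\<And>p q. P p \<Longrightarrow> P q \<Longrightarrow> P (p + q)"
  shows "P p"
proof (induction p rule: Poly_Mapping.update_induct)
  case const
  show ?case by (fact assms(1))
next
  case (update p u c)
  have "Poly_Mapping.update u c p = Poly_Mapping.single u c + p"
    using update.hyps
    by (intro poly_mapping_eqI) (auto simp: lookup_update lookup_add lookup_single in_keys_iff)
  then show ?case
    using assms(2,3) update.IH by metis
qed

lemma regrade_single_mult:
  "regrade v (Poly_Mapping.single u c * p) =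
     [:Poly_Mapping.single u c:] * regrade (\<lambda>u'. v (u + u')) p"
proof (induction p rule: mpol_induct)
  case (single u' c')
  show ?case
    by (simp add: mult_single regrade_single smult_monom)
qed (simp_all add: regrade_0 regrade_add algebra_simps)

text \<open>
  Homogenization to weight \<open>d\<close> instead of to the weight of \<open>f\<close>. Fixing \<open>d\<close> makes it additive in
  \<open>f\<close>, whereas the maximal weight may drop in a sum. Terms of weight above \<open>d\<close> get exponent \<open>0\<close>, so
  the result is related to \<open>homog \<omega> \<epsilon> f\<close> only for \<open>d \<ge> max_weight \<omega> \<epsilon> f\<close>.
\<close>

definition homog_to ::
  "('n::finite \<Rightarrow> nat) \<Rightarrow> ('m::finite \<Rightarrow> nat) \<Rightarrow> nat \<Rightarrow> ('n, 'k::comm_ring_1, 'm) free_mod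
    \<Rightarrow> ('n, 'k, 'm) free_mod_t" where
  "homog_to \<omega> \<epsilon> d f = (\<chi> j. regrade (\<lambda>u. d - mon_weight \<omega> \<epsilon> u j) (f $ j))"

lemma homog_to_0: "homog_to \<omega> \<epsilon> d 0 = 0"
  by (simp add: homog_to_def regrade_0 vec_eq_iff)

lemma homog_to_add: "homog_to \<omega> \<epsilon> d (f + g) = homog_to \<omega> \<epsilon> d f + homog_to \<omega> \<epsilon> d g"
  by (simp add: homog_to_def regrade_add vec_eq_iff)

text \<open>
  This holds for every \<open>d\<close>, even one below the weights that occur, because truncated subtraction still
  satisfies \<open>d - (m + n) = d - m - n\<close>.
\<close>

lemma homog_to_monomial_scale:
  "homog_to \<omega> \<epsilon> d (Poly_Mapping.single u c *s f) =
     [:Poly_Mapping.single u c:] *s homog_to \<omega> \<epsilon> (d - (\<Sum>x\<in>UNIV. \<omega> x * Poly_Mapping.lookup u x)) f"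
  by (simp add: homog_to_def regrade_single_mult vec_eq_iff mon_weight_def lookup_add
      sum.distrib distrib_left add.assoc)

lemma homog_to_eq_tvar_power:
  fixes f :: "('n::finite, 'k::comm_ring_1, 'm::finite) free_mod"
  assumes "max_weight \<omega> \<epsilon> f \<le> d"
  shows "homog_to \<omega> \<epsilon> d f = tvar ^ (d - max_weight \<omega> \<epsilon> f) *s homog \<omega> \<epsilon> f"
proof -
  let ?k = "d - max_weight \<omega> \<epsilon> f"
  have t: "tvar ^ ?k = (monom 1 ?k :: ('n, 'k) mpol_t)"
    by (simp add: tvar_def monom_altdef)
  have "d - mon_weight \<omega> \<epsilon> u j = ?k + (max_weight \<omega> \<epsilon> f - mon_weight \<omega> \<epsilon> u j)"
    if "u \<in> Poly_Mapping.keys (f $ j)" for u j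
    using max_weight_ge[OF that, of \<omega> \<epsilon>] assms by simp
  then show ?thesis
    by (simp add: homog_to_def regrade_def homog_def vec_eq_iff t sum_distrib_left mult_monom)
qed

text \<open>
  The \<open>f\<close> with this property form a submodule: additivity handles sums, and multiplying by a monomial
  only shifts \<open>d\<close>, which does not affect a statement about all large \<open>d\<close>. General scalars are sums of
  monomials. A generator belongs to it since for large \<open>d\<close> its image is a power of \<open>t\<close> times its
  homogenization.
\<close>

lemma eventually_homog_to_mem:
  fixes G :: "('n::finite, 'k::comm_ring_1, 'm::finite) free_mod set"
  assumes "f \<in> submod_gen G"
  shows "\<forall>\<^sub>F d in sequentially. homog_to \<omega> \<epsilon> d f \<in> submod_gen (homog \<omega> \<epsilon> ` G)"
    (is "\<forall>\<^sub>F d in _. homog_to \<omega> \<epsilon> d f \<in> ?N")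
proof -
  let ?S = "{f. \<forall>\<^sub>F d in sequentially. homog_to \<omega> \<epsilon> d f \<in> ?N}"
  have S_zero: "0 \<in> ?S"
    by (simp add: homog_to_0 free_module.span_zero)
  have S_add: "g + h \<in> ?S" if "g \<in> ?S" "h \<in> ?S" for g h
    using that by (auto simp: homog_to_add elim: eventually_elim2 intro: free_module.span_add)
  have S_scale: "a *s g \<in> ?S" if g: "g \<in> ?S" for a g
  proof (induction a rule: mpol_induct)
    case (single u c)
    let ?w = "\<Sum>x\<in>UNIV. \<omega> x * Poly_Mapping.lookup u x"
    have "filterlim (\<lambda>d. d - ?w) sequentially sequentially"
      by (rule filterlim_minus_const_nat_at_top)
    then have "\<forall>\<^sub>F d in sequentially. homog_to \<omega> \<epsilon> (d - ?w) g \<in> ?N"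
      using g unfolding mem_Collect_eq by (rule eventually_compose_filterlim[rotated])
    then show ?case
      by (auto simp: homog_to_monomial_scale elim!: eventually_mono intro: free_module.span_scale)
  next
    case (add p q)
    then show ?case
      unfolding free_module.scale_left_distrib by (rule S_add)
  qed (use S_zero in simp)
  have "homog_to \<omega> \<epsilon> d g \<in> ?N" if "g \<in> G" "d \<ge> max_weight \<omega> \<epsilon> g" for d g
    using that by (auto simp: homog_to_eq_tvar_power intro: free_module.span_scale free_module.span_base)
  then have "G \<subseteq> ?S"
    by (auto simp: eventually_sequentially)
  then have "submod_gen G \<subseteq> ?S"
    by (rule free_module.span_minimal) (rule free_module.subspaceI[OF S_zero S_add S_scale])
  then show ?thesis
    using assms by blast
qed

theorem corollary4p3:
  fixes \<omega> :: "'n::finite \<Rightarrow> nat"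
    and \<epsilon> :: "'m::finite \<Rightarrow> nat"
    and M :: "('n, 'k::field, 'm) free_mod set"
    and f :: "nat \<Rightarrow> ('n, 'k, 'm) free_mod"
    and r s :: nat
    and \<Phi> :: "nat \<Rightarrow> nat \<Rightarrow> ('n, 'k) mpol"
  assumes M_gen: "M = submod_gen (f ` {..<r})"
    and presentation: "is_presentation s r \<Phi> (\<lambda>i. initial_form \<omega> \<epsilon> (f i))"
  shows "homog_syz_image \<omega> \<epsilon> s r \<Phi> f \<subseteq> range ((*s) tvar) \<and>
    (div_t (homog_syz_image \<omega> \<epsilon> s r \<Phi> f) \<subseteq> submod_gen ((\<lambda>i. homog \<omega> \<epsilon> (f i)) ` {..<r}) \<longrightarrow>
       initial_module \<omega> \<epsilon> M = submod_gen ((\<lambda>i. initial_form \<omega> \<epsilon> (f i)) ` {..<r}))"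
proof (intro conjI impI)
  show "homog_syz_image \<omega> \<epsilon> s r \<Phi> f \<subseteq> range ((*s) tvar)"
    using presentation by (rule syzygy_image_subset_tvar)
next
  let ?N = "submod_gen ((\<lambda>i. homog \<omega> \<epsilon> (f i)) ` {..<r})"
  let ?I = "submod_gen ((\<lambda>i. initial_form \<omega> \<epsilon> (f i)) ` {..<r})"
  assume lift: "div_t (homog_syz_image \<omega> \<epsilon> s r \<Phi> f) \<subseteq> ?N"
  have cancel: "g \<in> ?N" if "tvar ^ k *s g \<in> ?N" for k g
    using that
  proof (induction k)
    case (Suc k)
    then show ?case
      using tvar_saturated[OF presentation lift, of "tvar ^ k *s g"]
      by (simp add: vector_smult_assoc)
  qed simp
  have "initial_form \<omega> \<epsilon> g \<in> ?I" if "g \<in> M" for g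
  proof -
    have "\<forall>\<^sub>F d in sequentially. homog_to \<omega> \<epsilon> d g \<in> ?N"
      using eventually_homog_to_mem[of g "f ` {..<r}" \<omega> \<epsilon>] that M_gen by (simp add: image_image)
    then have "\<forall>\<^sub>F d in sequentially. homog_to \<omega> \<epsilon> d g \<in> ?N \<and> max_weight \<omega> \<epsilon> g \<le> d"
      using eventually_ge_at_top by (rule eventually_conj)
    then obtain d where "homog_to \<omega> \<epsilon> d g \<in> ?N" "max_weight \<omega> \<epsilon> g \<le> d"
      by (auto simp: eventually_sequentially)
    then have "homog \<omega> \<epsilon> g \<in> ?N"
      using cancel by (simp add: homog_to_eq_tvar_power)
    then obtain a where "homog \<omega> \<epsilon> g = gens_map r (\<lambda>i. homog \<omega> \<epsilon> (f i)) a"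
      unfolding submod_gen_eq_range_gens_map by blast
    then have "eval_0 (homog \<omega> \<epsilon> g) = eval_0 (gens_map r (\<lambda>i. homog \<omega> \<epsilon> (f i)) a)"
      by (rule arg_cong)
    then show ?thesis
      unfolding submod_gen_eq_range_gens_map eval_0_gens_map eval_0_homog by simp
  qed
  then have "initial_module \<omega> \<epsilon> M \<subseteq> ?I"
    unfolding initial_module_def
    by (intro free_module.span_minimal free_module.subspace_span) auto
  moreover have "initial_form \<omega> \<epsilon> (f i) \<in> initial_module \<omega> \<epsilon> M" if "i < r" for i
  \<comment> \<open>The generators of the initial module are the initial forms of nonzero elements only.\<close>
  proof (cases "f i = 0")
    case True
    then have "initial_form \<omega> \<epsilon> (f i) = 0"
      by (simp add: initial_form_def vec_eq_iff)
    then show ?thesis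
      unfolding initial_module_def by (simp add: free_module.span_zero)
  next
    case False
    have "f i \<in> M"
      unfolding M_gen using that by (intro free_module.span_base) simp
    then show ?thesis
      unfolding initial_module_def using False by (intro free_module.span_base) blast
  qed
  then have "?I \<subseteq> initial_module \<omega> \<epsilon> M"
    unfolding initial_module_def
    by (intro free_module.span_minimal free_module.subspace_span) auto
  ultimately show "initial_module \<omega> \<epsilon> M = ?I"
    by blast
qed

end
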